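(* Let $\mathcal X\subseteq\mathbb R^n$ be closed, let $\mathcal H$ be a properly constrained hypothesis on $\mathcal X$, and let $\Phi:\mathcal X\to\mathbb R^m$ be a constraint for $\mathcal H$. Then the dual e-class $$\mathcal E_{\mathcal H}^\vee=\{1-\lambda\cdot\Phi\;:\;\lambda\in\Lambda_\Phi\},\qquad \Lambda_\Phi=\Big\{\lambda\in\mathbb R^m\;:\;\sup_{x\in\mathcal X}\lambda\cdot\Phi(x)\le 1\Big\},$$ is the optimal e-class for $\mathcal H$.
   Context: $\mathcal P_{\mathcal X}$ denotes the set of Borel probability measures on the closed set $\mathcal X\subseteq\mathbb R^n$, and $\langle P,f\rangle$ the expectation of $f$ under $P$. A hypothesis on $\mathcal X$ is a non-empty subset $\mathcal H\subseteq\mathcal P_{\mathcal X}$. An e-variable for $\mathcal H$ is a Borel function $E:\mathcal X\to[0,+\infty)$ with $\langle P,E\rangle\le 1$ for all $P\in\mathcal H$; $\mathcal E_{\mathcal H}$ is the set of all e-variables, and an e-class is a subset of $\mathcal E_{\mathcal H}$. For real functions on $\mathcal X$, $f\succeq f'$ means $f(x)\ge f'(x)$ for all $x\in\mathcal X$. An e-class $\mathcal E\subseteq\mathcal E_{\mathcal H}$ is majorising if for every $E\in\mathcal E_{\mathcal H}$ there is $E'\in\mathcal E$ with $E'\succeq E$. A majorising e-class contained in every other majorising e-class is called optimal (if it exists, it is unique). For Borel $\Phi:\mathcal X\to\mathbb R^m$ ($m\ge 0$, $\mathbb R^0=\{0\}$), $\mathcal P_\Phi=\{P\in\mathcal P_{\mathcal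 X}:\langle P,\|\Phi\|_1\rangle<+\infty\}$. A constraint for $\mathcal H$ is a continuous $\Phi:\mathcal X\to\mathbb R^m$ (for some $m$) such that $\mathcal H=\{P\in\mathcal P_\Phi:\langle P,\Phi\rangle=0\}$. It is proper if $0\in\mathrm{rel\,int}(\mathrm{conv}\,\Phi(\mathcal X))$. A hypothesis is properly constrained if it admits a proper constraint. *)

theory Defs
  imports "HOL-Probability.Probability" "HOL-Library.Function_Algebras"
begin

text \<open>
  The dimension \<open>m\<close> of the codomain of a constraint has to be quantified over inside definitions, so
  \<open>\<real>\<^sup>m\<close> is the carrier of \<^term>\<open>Euclidean_space m\<close>: the functions \<open>nat \<Rightarrow> real\<close> vanishing from
  index \<open>m\<close> onwards, with the topology of coordinatewise convergence (for \<open>m = 0\<close> this is \<open>{0}\<close>).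
  The pointwise vector space structure on functions gives convex and affine hulls there their usual
  meaning; both hulls stay inside \<open>\<real>\<^sup>m\<close>, where the product topology of \<open>nat \<Rightarrow> real\<close>
  is the Euclidean one, so \<^const>\<open>rel_interior\<close> is the usual relative interior as well.
\<close>

instantiation "fun" :: (type, real_vector) real_vector
begin

definition scaleR_fun :: "real \<Rightarrow> ('a \<Rightarrow> 'b) \<Rightarrow> 'a \<Rightarrow> 'b"
  where "scaleR_fun c f = (\<lambda>x. c *\<^sub>R f x)"

instance
  by standard (auto simp: scaleR_fun_def fun_eq_iff scaleR_add_right scaleR_add_left)

end

definition dotp :: "nat \<Rightarrow> (nat \<Rightarrow> real) \<Rightarrow> (nat \<Rightarrow> real) \<Rightarrow> real"
  where "dotp m u v = (\<Sum>i<m. u i * v i)"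

definition norm1 :: "nat \<Rightarrow> (nat \<Rightarrow> real) \<Rightarrow> real"
  where "norm1 m v = (\<Sum>i<m. \<bar>v i\<bar>)"

definition borel_on :: "'a::topological_space set \<Rightarrow> 'a measure"
  where "borel_on X = restrict_space borel X"

definition prob_measures :: "'a::topological_space set \<Rightarrow> 'a measure set"
  where "prob_measures X = {P. prob_space P \<and> sets P = sets (borel_on X)}"

definition hypothesis :: "'a::topological_space set \<Rightarrow> 'a measure set \<Rightarrow> bool"
  where "hypothesis X H \<longleftrightarrow> H \<noteq> {} \<and> H \<subseteq> prob_measures X"

text \<open>
  A function \<open>X \<rightarrow> [0, \<infinity>)\<close> is represented by its extension by \<^const>\<open>undefined\<close> outside \<open>X\<close>, so that
  equality and inclusion of e-classes only depend on the values on \<open>X\<close>. The expectation of an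
  e-variable may be infinite, hence the nonnegative integral.
\<close>

definition e_variables :: "'a::topological_space set \<Rightarrow> 'a measure set \<Rightarrow> ('a \<Rightarrow> real) set"
  where "e_variables X H =
    {E \<in> X \<rightarrow>\<^sub>E {0..}. E \<in> borel_measurable (borel_on X) \<and>
       (\<forall>P\<in>H. (\<integral>\<^sup>+x. ennreal (E x) \<partial>P) \<le> 1)}"

definition e_class :: "'a::topological_space set \<Rightarrow> 'a measure set \<Rightarrow> ('a \<Rightarrow> real) set \<Rightarrow> bool"
  where "e_class X H C \<longleftrightarrow> C \<subseteq> e_variables X H"

definition majorising :: "'a::topological_space set \<Rightarrow> 'a measure set \<Rightarrow> ('a \<Rightarrow> real) set \<Rightarrow> bool"
  where "majorising X H C \<longleftrightarrow> e_class X H C \<and>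
    (\<forall>E\<in>e_variables X H. \<exists>E'\<in>C. \<forall>x\<in>X. E' x \<ge> E x)"

definition optimal :: "'a::topological_space set \<Rightarrow> 'a measure set \<Rightarrow> ('a \<Rightarrow> real) set \<Rightarrow> bool"
  where "optimal X H C \<longleftrightarrow> majorising X H C \<and> (\<forall>C'. majorising X H C' \<longrightarrow> C \<subseteq> C')"

definition prob_measures_int ::
    "'a::topological_space set \<Rightarrow> nat \<Rightarrow> ('a \<Rightarrow> nat \<Rightarrow> real) \<Rightarrow> 'a measure set"
  where "prob_measures_int X m \<Phi> =
    {P \<in> prob_measures X. (\<integral>\<^sup>+x. ennreal (norm1 m (\<Phi> x)) \<partial>P) < \<infinity>}"

definition constraint ::
    "'a::topological_space set \<Rightarrow> 'a measure set \<Rightarrow> nat \<Rightarrow> ('a \<Rightarrow> nat \<Rightarrow> real) \<Rightarrow> bool"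
  where "constraint X H m \<Phi> \<longleftrightarrow>
    continuous_map (top_of_set X) (Euclidean_space m) \<Phi> \<and>
    H = {P \<in> prob_measures_int X m \<Phi>. \<forall>i<m. (\<integral>x. \<Phi> x i \<partial>P) = 0}"

definition proper_constraint ::
    "'a::topological_space set \<Rightarrow> 'a measure set \<Rightarrow> nat \<Rightarrow> ('a \<Rightarrow> nat \<Rightarrow> real) \<Rightarrow> bool"
  where "proper_constraint X H m \<Phi> \<longleftrightarrow>
    constraint X H m \<Phi> \<and> 0 \<in> rel_interior (convex hull (\<Phi> ` X))"

definition properly_constrained :: "'a::topological_space set \<Rightarrow> 'a measure set \<Rightarrow> bool"
  where "properly_constrained X H \<longleftrightarrow> (\<exists>m \<Phi>. proper_constraint X H m \<Phi>)"

definition dual_params :: "'a set \<Rightarrow> nat \<Rightarrow> ('a \<Rightarrow> nat \<Rightarrow> real) \<Rightarrow> (nat \<Rightarrow> real) set"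
  where "dual_params X m \<Phi> =
    {l \<in> topspace (Euclidean_space m). (SUP x\<in>X. ereal (dotp m l (\<Phi> x))) \<le> 1}"

definition dual_e_class :: "'a set \<Rightarrow> nat \<Rightarrow> ('a \<Rightarrow> nat \<Rightarrow> real) \<Rightarrow> ('a \<Rightarrow> real) set"
  where "dual_e_class X m \<Phi> = {\<lambda>x\<in>X. 1 - dotp m l (\<Phi> x) | l. l \<in> dual_params X m \<Phi>}"

end

theory Submission
  imports Defs
begin

text \<open>
  Properness means that every point of \<open>X\<close> is an atom of some finitely supported \<open>P \<in> H\<close>: a small
  negative multiple of \<open>\<Psi> x\<close> is a convex combination of values of the proper constraint \<open>\<Psi>\<close>. This
  property refers to \<open>H\<close> only, so it is available for an arbitrary, possibly improper looking,
  constraint \<open>\<Phi>\<close>. For an e-variable \<open>E\<close>, consider the convex cone generated by the points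
  \<open>(E x - 1, \<Phi> x)\<close>: its elements with vanishing \<open>\<Phi>\<close>-part are multiples of
  means under finitely supported elements of \<open>H\<close>, hence have nonpositive first coordinate, and the
  atoms show that the projection of the cone to the \<open>\<Phi>\<close>-part is a linear subspace. A Farkas
  argument gives a linear functional of \<open>\<Phi>\<close> dominating \<open>E - 1\<close>. Finally, two comparable elements of
  the dual e-class both have mean 1 under every \<open>P \<in> H\<close>, so they agree at every atom, that is, on \<open>X\<close>.
\<close>

section \<open>A Farkas lemma for cones\<close>

text \<open>
  The balance assumption says that the image of \<open>W\<close> under \<open>b\<close> is a linear subspace. In the
  induction step it excludes that \<open>b m\<close> takes only one sign, so the slopes \<open>a w / b m w\<close> are bounded.
\<close>

lemma farkas_balanced_cone:
  fixes a :: "'v::real_vector \<Rightarrow> real" and b :: "nat \<Rightarrow> 'v \<Rightarrow> real"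
  assumes W: "convex_cone W"
    and "linear a" "\<And>i. i < m \<Longrightarrow> linear (b i)"
    and "\<And>w. w \<in> W \<Longrightarrow> \<exists>w'\<in>W. \<forall>i<m. b i (w + w') = 0"
    and "\<And>w. w \<in> W \<Longrightarrow> \<forall>i<m. b i w = 0 \<Longrightarrow> a w \<le> 0"
  shows "\<exists>c. \<forall>w\<in>W. a w \<le> (\<Sum>i<m. c i * b i w)"
  using assms(2-5)
proof (induction m arbitrary: a)
  case 0
  then show ?case by simp
next
  case (Suc m)
  note lin_a = Suc.prems(1) and lin_b = Suc.prems(2) and balance = Suc.prems(3)
    and sign = Suc.prems(4)
  define W0 where "W0 = {w \<in> W. \<forall>i<m. b i w = 0}"
  have lin_m: "linear (b m)" using lin_b by simp
  have slope_le: "a w / b m w \<le> a w' / b m w'"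
    if "w \<in> W0" "w' \<in> W0" "b m w > 0" "b m w' < 0" for w w'
  proof -
    \<comment> \<open>Both coefficients are positive and are chosen so that \<open>b m\<close>
      cancels; the other \<open>b i\<close> vanish on \<open>W0\<close>, so \<open>sign\<close>
      applies to \<open>?u\<close>.\<close>
    let ?u = "(- b m w') *\<^sub>R w + b m w *\<^sub>R w'"
    have "?u \<in> W"
      using that unfolding W0_def
      by (intro convex_cone_add[OF W] convex_cone_scaleR[OF W]) auto
    moreover have "b i ?u = 0" if "i < Suc m" for i
      using that \<open>w \<in> W0\<close> \<open>w' \<in> W0\<close> linear_diff[OF lin_b[OF that]] linear_scale[OF lin_b[OF that]]
      by (cases "i = m") (auto simp: W0_def)
    ultimately have "a ?u \<le> 0" using sign by blast
    then have "- b m w' * a w + b m w * a w' \<le> 0"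
      by (simp add: linear_diff[OF lin_a] linear_scale[OF lin_a])
    with that show ?thesis by (simp add: field_simps)
  qed
  \<comment> \<open>\<open>t\<close> becomes the coefficient of \<open>b m\<close>. It must lie
    above all slopes on the side \<open>b m w > 0\<close> and below all slopes on the side
    \<open>b m w < 0\<close>.\<close>
  have "\<exists>t. \<forall>w\<in>W0. a w \<le> t * b m w"
  proof (cases "\<forall>w\<in>W0. b m w = 0")
    case True
    then have "\<forall>w\<in>W0. a w \<le> 0 * b m w"
      using sign by (auto simp: W0_def less_Suc_eq)
    then show ?thesis by blast
  next
    case False
    then obtain w0 where w0: "w0 \<in> W0" "b m w0 \<noteq> 0" by blast
    \<comment> \<open>The balancing partner \<open>w1\<close> stays in \<open>W0\<close> and
      reverses the sign of \<open>b m\<close>. Hence both signs occur, which makes \<open>L\<close>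
      below non-empty and bounded above.\<close>
    then obtain w1 where w1: "w1 \<in> W" "\<forall>i<Suc m. b i (w0 + w1) = 0"
      using balance unfolding W0_def by blast
    have sum0: "b i w0 + b i w1 = 0" if "i < Suc m" for i
      using w1(2) that linear_add[OF lin_b[OF that]] by metis
    then have "b i w1 = 0" if "i < m" for i
      proof -
    have "b i w0 = 0" using that w0(1) by (simp add: W0_def)
    with sum0[of i] that show ?thesis by simp
  qed
    with w1(1) have "w1 \<in> W0" by (simp add: W0_def)
    moreover have "b m w1 = - b m w0" using sum0[of m] by simp
    ultimately obtain p n where p: "p \<in> W0" "b m p > 0" and n: "n \<in> W0" "b m n < 0"
      using w0 by (metis linorder_neqE_linordered_idom neg_0_less_iff_less neg_less_0_iff_less)
    define L where "L = {a w / b m w |w. w \<in> W0 \<and> b m w > 0}"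
    have ub: "l \<le> a w' / b m w'" if "l \<in> L" "w' \<in> W0" "b m w' < 0" for l w'
      using that slope_le unfolding L_def by blast
    have "L \<noteq> {}" using p unfolding L_def by blast
    have "bdd_above L" using ub n by (meson bdd_aboveI)
    have "a w \<le> Sup L * b m w" if w: "w \<in> W0" for w
    proof (cases "b m w" "0::real" rule: linorder_cases)
      case less
      have "Sup L \<le> a w / b m w"
        using \<open>L \<noteq> {}\<close> ub[OF _ w less] by (rule cSup_least)
      with less show ?thesis by (simp add: field_simps)
    next
      case equal
      then show ?thesis using w sign by (auto simp: W0_def less_Suc_eq)
    next
      case greater
      have "a w / b m w \<le> Sup L"
        using greater w \<open>bdd_above L\<close> by (intro cSup_upper) (auto simp: L_def)
      with greater show ?thesis by (simp add: field_simps)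
    qed
    then show ?thesis by blast
  qed
  then obtain t where t: "\<And>w. w \<in> W0 \<Longrightarrow> a w \<le> t * b m w" by blast
  \<comment> \<open>The choice of \<open>t\<close> is exactly the sign condition for
    \<open>a - t * b m\<close> with the first \<open>m\<close> functionals, so the induction
    hypothesis applies to this new objective.\<close>
  have "\<exists>c. \<forall>w\<in>W. a w - t * b m w \<le> (\<Sum>i<m. c i * b i w)"
  proof (rule Suc.IH)
    show "linear (\<lambda>w. a w - t * b m w)"
      using linear_compose_sub[OF lin_a linear_compose_scale_right[OF lin_m, of t]] by simp
    show "\<exists>w'\<in>W. \<forall>i<m. b i (w + w') = 0" if "w \<in> W" for w
      using balance[OF that] by (meson less_Suc_eq)
    show "a w - t * b m w \<le> 0" if "w \<in> W" "\<forall>i<m. b i w = 0" for w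
      using t that by (auto simp: W0_def)
  qed (use lin_b in auto)
  then obtain c where "\<forall>w\<in>W. a w - t * b m w \<le> (\<Sum>i<m. c i * b i w)" by blast
  then have "\<forall>w\<in>W. a w \<le> (\<Sum>i<Suc m. (c(m := t)) i * b i w)"
    by (auto simp: algebra_simps)
  then show ?case by blast
qed

section \<open>Finitely supported probability measures\<close>

text \<open>Choosing one preimage for each point of the finite combination moves the weights to
  points of \<open>X\<close>, where they can serve as point masses.\<close>

lemma convex_hull_image_explicit:
  fixes h :: "'a \<Rightarrow> 'v::real_vector"
  assumes "y \<in> convex hull (h ` X)"
  obtains F w where "finite F" "F \<subseteq> X" "\<And>x. x \<in> F \<Longrightarrow> 0 \<le> w x" "sum w F = 1"
    "(\<Sum>x\<in>F. w x *\<^sub>R h x) = y"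
proof -
  obtain S u where S: "finite S" "S \<subseteq> h ` X" "\<forall>v\<in>S. 0 \<le> u v" "sum u S = 1"
    and y: "(\<Sum>v\<in>S. u v *\<^sub>R v) = y"
    using assms unfolding convex_hull_explicit by blast
  obtain F where F: "F \<subseteq> X" "inj_on h F" "S = h ` F"
    using S(2) by (auto simp: subset_image_inj)
  show thesis
  proof (rule that[of F "u \<circ> h"])
    show "finite F" using F S(1) finite_image_iff by blast
    show "sum (u \<circ> h) F = 1" using F S(4) by (simp add: sum.reindex)
    show "(\<Sum>x\<in>F. (u \<circ> h) x *\<^sub>R h x) = y" using F y by (simp add: sum.reindex)
  qed (use F S in auto)
qed

text \<open>This is the weighted sum of Dirac measures at the points of \<open>F\<close>. Pushing
  forward along the identity replaces the power set of \<open>F\<close> by the Borel sets of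
  \<open>X\<close>, as \<open>prob_measures\<close> demands.\<close>

definition finite_prob :: "'a::topological_space set \<Rightarrow> 'a set \<Rightarrow> ('a \<Rightarrow> real) \<Rightarrow> 'a measure"
  where "finite_prob X F w = distr (point_measure F (\<lambda>x. ennreal (w x))) (borel_on X) (\<lambda>x. x)"

context
  fixes X F :: "'a::topological_space set" and w :: "'a \<Rightarrow> real"
  assumes F: "finite F" "F \<subseteq> X" and w: "\<And>x. x \<in> F \<Longrightarrow> 0 \<le> w x"
begin

lemma measurable_id_point_measure:
  "(\<lambda>x. x) \<in> measurable (point_measure F (\<lambda>x. ennreal (w x))) (borel_on X)"
  using F by (auto simp: measurable_def space_point_measure sets_point_measure borel_on_def
      space_restrict_space)

lemma finite_prob_in_prob_measures:
  assumes "sum w F = 1"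
  shows "finite_prob X F w \<in> prob_measures X"
proof -
  have "prob_space (point_measure F (\<lambda>x. ennreal (w x)))"
    using F w assms by (auto intro!: prob_spaceI
        simp: space_point_measure emeasure_point_measure_finite sum_ennreal)
  then show ?thesis
    unfolding prob_measures_def finite_prob_def
    by (auto intro!: prob_space.prob_space_distr measurable_id_point_measure)
qed

lemma integral_finite_prob:
  fixes f :: "'a \<Rightarrow> real"
  assumes "f \<in> borel_measurable (borel_on X)"
  shows "(\<integral>x. f x \<partial>finite_prob X F w) = (\<Sum>x\<in>F. w x * f x)"
  unfolding finite_prob_def
  using F w assms
  by (simp add: integral_distr[OF measurable_id_point_measure]
      lebesgue_integral_point_measure_finite)

lemma nn_integral_finite_prob:
  assumes "f \<in> borel_measurable (borel_on X)" "\<And>x. x \<in> X \<Longrightarrow> 0 \<le> f x"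
  shows "(\<integral>\<^sup>+x. ennreal (f x) \<partial>finite_prob X F w) = ennreal (\<Sum>x\<in>F. w x * f x)"
proof -
  have "(\<integral>\<^sup>+x. ennreal (f x) \<partial>finite_prob X F w) = (\<Sum>x\<in>F. ennreal (w x) * ennreal (f x))"
    unfolding finite_prob_def using F(1) assms
    by (simp add: nn_integral_distr[OF measurable_id_point_measure]
        nn_integral_point_measure_finite)
  also have "\<dots> = (\<Sum>x\<in>F. ennreal (w x * f x))"
    using F assms w by (intro sum.cong refl) (auto simp: ennreal_mult)
  also have "\<dots> = ennreal (\<Sum>x\<in>F. w x * f x)"
    using F assms w by (intro sum_ennreal) auto
  finally show ?thesis .
qed

end

lemma borel_measurable_constraint:
  assumes "constraint X H m \<Phi>"
  shows "(\<lambda>x. \<Phi> x i) \<in> borel_measurable (borel_on X)"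
proof -
  have "continuous_map (top_of_set X) (powertop_real UNIV) \<Phi>"
    using assms unfolding constraint_def Euclidean_space_def
    by (auto dest: continuous_map_into_fulltopology)
  then have "continuous_on X (\<lambda>x. \<Phi> x i)"
    by (simp add: continuous_map_componentwise_UNIV)
  then show ?thesis
    unfolding borel_on_def by (rule borel_measurable_continuous_on_restrict)
qed

text \<open>Finite support makes integrability automatic, so only the moment equations remain. As
  \<open>H\<close> does not depend on the chosen constraint, the equivalence carries information
  from one constraint of \<open>H\<close> to another.\<close>

lemma finite_prob_in_hypothesis_iff:
  assumes c: "constraint X H m \<Phi>" and F: "finite F" "F \<subseteq> X"
    and w: "\<And>x. x \<in> F \<Longrightarrow> 0 \<le> w x" "sum w F = 1"
  shows "finite_prob X F w \<in> H \<longleftrightarrow> (\<forall>i<m. (\<Sum>x\<in>F. w x * \<Phi> x i) = 0)"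
proof -
  have [measurable]: "(\<lambda>x. \<Phi> x i) \<in> borel_measurable (borel_on X)" for i
    using c by (rule borel_measurable_constraint)
  have "(\<lambda>x. norm1 m (\<Phi> x)) \<in> borel_measurable (borel_on X)"
    unfolding norm1_def by measurable
  then have "(\<integral>\<^sup>+x. ennreal (norm1 m (\<Phi> x)) \<partial>finite_prob X F w) < \<infinity>"
    using nn_integral_finite_prob[of F X w "\<lambda>x. norm1 m (\<Phi> x)"] F w
    by (simp add: norm1_def sum_nonneg)
  then show ?thesis
    using c finite_prob_in_prob_measures[OF F w] integral_finite_prob[OF F w(1)]
    unfolding constraint_def prob_measures_int_def by simp
qed

section \<open>Relative interior and atoms of measures in \<open>H\<close>\<close>

text \<open>The line through \<open>0\<close> and \<open>y\<close> lies in the affine hull, and near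
  \<open>0\<close> it stays in an open set whose trace on that hull lies in \<open>S\<close>.
  Continuity of the line is checked coordinatewise, since functions carry the product
  topology.\<close>

lemma mem_rel_interior_uminus_scaleR:
  fixes y :: "'i \<Rightarrow> real"
  assumes "0 \<in> rel_interior S" "y \<in> S"
  obtains e where "e > 0" "- (e *\<^sub>R y) \<in> S"
proof -
  obtain U where U: "open U" "0 \<in> U \<inter> S" "U \<inter> affine hull S \<subseteq> S"
    using assms(1) mem_rel_interior by blast
  define g where "g = (\<lambda>t::real. - (t *\<^sub>R y))"
  have "continuous_on UNIV g"
    unfolding g_def
    by (intro continuous_on_coordinatewise_then_product)
      (auto simp: scaleR_fun_def intro!: continuous_intros)
  with U(1) have "open (g -` U)" by (rule open_vimage)
  moreover have "0 \<in> g -` U" using U(2) by (simp add: g_def)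
  ultimately obtain e where "e > 0" and e: "\<And>t. dist t 0 < e \<Longrightarrow> t \<in> g -` U"
    by (metis open_dist)
  have "g (e / 2) \<in> U" using e[of "e / 2"] \<open>e > 0\<close> by simp
  moreover have "g t \<in> affine hull S" for t
  proof -
    have "0 \<in> affine hull S" "y \<in> affine hull S"
      using U(2) assms(2) by (auto intro: hull_inc)
    \<comment> \<open>The affine combination is
      \<open>(1 + t) *\<^sub>R 0 + (- t) *\<^sub>R y\<close>.\<close>
    from mem_affine[OF affine_affine_hull this, of "1 + t" "- t"] show ?thesis
      by (simp add: g_def)
  qed
  ultimately have "g (e / 2) \<in> S" using U(3) by blast
  then show thesis using that[of "e / 2"] \<open>e > 0\<close> by (simp add: g_def)
qed

lemma sum_fun_apply: "(\<Sum>x\<in>F. f x) i = (\<Sum>x\<in>F. f x i)" for f :: "'a \<Rightarrow> 'b \<Rightarrow> real"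
  by (induction F rule: infinite_finite_induct) auto

text \<open>Adding mass \<open>e\<close> at \<open>x\<close> to a convex combination with mean
  \<open>- (e *\<^sub>R \<Psi> x)\<close> makes the mean of \<open>\<Psi>\<close> vanish; division
  by \<open>1 + e\<close> restores total mass 1.\<close>

lemma properly_constrained_atom:
  assumes "properly_constrained X H" "x \<in> X"
  obtains F w where "finite F" "F \<subseteq> X" "x \<in> F" "\<And>y. y \<in> F \<Longrightarrow> 0 \<le> w y" "w x > 0"
    "sum w F = 1" "finite_prob X F w \<in> H"
proof -
  obtain k \<Psi> where c: "constraint X H k \<Psi>" and rel: "0 \<in> rel_interior (convex hull (\<Psi> ` X))"
    using assms(1) unfolding properly_constrained_def proper_constraint_def by blast
  have "\<Psi> x \<in> convex hull (\<Psi> ` X)" using assms(2) by (simp add: hull_inc)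
  with rel obtain e where "e > 0" and "- (e *\<^sub>R \<Psi> x) \<in> convex hull (\<Psi> ` X)"
    by (rule mem_rel_interior_uminus_scaleR)
  then obtain F w where F: "finite F" "F \<subseteq> X" and w: "\<And>y. y \<in> F \<Longrightarrow> 0 \<le> w y" "sum w F = 1"
    and eq: "(\<Sum>y\<in>F. w y *\<^sub>R \<Psi> y) = - (e *\<^sub>R \<Psi> x)"
    by (elim convex_hull_image_explicit) blast
  \<comment> \<open>The two summands are kept separate because \<open>x\<close> may already belong
    to \<open>F\<close>.\<close>
  define v where "v = (\<lambda>y. ((if y \<in> F then w y else 0) + (if y = x then e else 0)) / (1 + e))"
  have sum_v: "(\<Sum>y\<in>insert x F. v y * f y) = ((\<Sum>y\<in>F. w y * f y) + e * f x) / (1 + e)"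
    for f :: "_ \<Rightarrow> real"
  proof -
    have "(\<Sum>y\<in>insert x F. v y * f y) =
        (\<Sum>y\<in>insert x F. (if y \<in> F then w y * f y else 0) + (if y = x then e * f y else 0)) / (1 + e)"
      unfolding sum_divide_distrib by (intro sum.cong) (auto simp: v_def algebra_simps)
    also have "(\<Sum>y\<in>insert x F. if y \<in> F then w y * f y else 0) = (\<Sum>y\<in>F. w y * f y)"
      using F(1) by (subst sum.inter_restrict[symmetric]) (auto intro!: sum.cong)
    ultimately show ?thesis
      using F(1) by (simp add: sum.distrib sum.delta)
  qed
  show thesis
  proof (rule that[of "insert x F" v])
    show "finite (insert x F)" "insert x F \<subseteq> X" "x \<in> insert x F" using F assms(2) by auto
    show nn: "0 \<le> v y" if "y \<in> insert x F" for y
      using that w(1) \<open>e > 0\<close> by (auto simp: v_def)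
    show "v x > 0" using w(1)[of x] \<open>e > 0\<close> by (auto simp: v_def intro: add_nonneg_pos)
    show sum1: "sum v (insert x F) = 1"
      using sum_v[of "\<lambda>_. 1"] w(2) \<open>e > 0\<close> by simp
    have "(\<Sum>y\<in>F. w y * \<Psi> y i) = - (e * \<Psi> x i)" for i
      using fun_cong[OF eq, of i] by (simp add: sum_fun_apply scaleR_fun_def)
    then have "(\<Sum>y\<in>insert x F. v y * \<Psi> y i) = 0" for i
      by (simp add: sum_v)
    then show "finite_prob X (insert x F) v \<in> H"
      using finite_prob_in_hypothesis_iff[OF c _ _ nn sum1] F assms(2) by simp
  qed
qed

section \<open>Majorising an e-variable by a dual function\<close>

lemma sum_e_variable_le_1:
  assumes "E \<in> e_variables X H" and F: "finite F" "F \<subseteq> X" "\<And>x. x \<in> F \<Longrightarrow> 0 \<le> w x"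
    and "finite_prob X F w \<in> H"
  shows "(\<Sum>x\<in>F. w x * E x) \<le> 1"
proof -
  have E: "E \<in> borel_measurable (borel_on X)" "\<And>x. x \<in> X \<Longrightarrow> 0 \<le> E x"
    "(\<integral>\<^sup>+x. ennreal (E x) \<partial>finite_prob X F w) \<le> 1"
    using assms by (auto simp: e_variables_def)
  then show ?thesis
    using nn_integral_finite_prob[OF F E(1,2)] by simp
qed

lemma e_variable_le_dual:
  assumes pc: "properly_constrained X H" and c: "constraint X H m \<Phi>"
    and E: "E \<in> e_variables X H"
  obtains l where "\<And>x. x \<in> X \<Longrightarrow> E x \<le> 1 - (\<Sum>i<m. l i * \<Phi> x i)"
proof -
  define h where "h = (\<lambda>x. (E x - 1, \<Phi> x))"
  define W where "W = convex_cone hull (h ` X)"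
  \<comment> \<open>\<open>W2\<close> collects the vectors with a balancing partner in
    \<open>W\<close>. It is itself a convex cone, so balance needs checking only at the generators
    \<open>h x\<close>.\<close>
  define W2 where "W2 = {w. \<exists>w'\<in>W. \<forall>i<m. snd (w + w') i = 0}"
  have W: "convex_cone W" unfolding W_def by (rule convex_cone_convex_cone_hull)
  have h_W: "h x \<in> W" if "x \<in> X" for x
    using that unfolding W_def by (simp add: hull_inc)
  have "\<exists>c. \<forall>w\<in>W. fst w \<le> (\<Sum>i<m. c i * snd w i)"
  proof (rule farkas_balanced_cone[OF W])
    show "linear (fst :: real \<times> (nat \<Rightarrow> real) \<Rightarrow> real)"
      by (rule linearI) auto
    show "linear (\<lambda>w. snd w i)" for i and w :: "real \<times> (nat \<Rightarrow> real)"
      by (rule linearI) (auto simp: scaleR_fun_def)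
  next
    have "convex_cone W2"
      unfolding convex_cone_iff
    proof (intro conjI ballI allI impI)
      show "0 \<in> W2" using convex_cone_contains_0[OF W] by (auto simp: W2_def intro!: bexI[of _ 0])
      show "x + y \<in> W2" if xy: "x \<in> W2" "y \<in> W2" for x y
      proof -
        from xy obtain x' y' where "x' \<in> W" "y' \<in> W"
          "\<forall>i<m. snd (x + x') i = 0" "\<forall>i<m. snd (y + y') i = 0"
          unfolding W2_def by blast
        then have "x' + y' \<in> W" "\<forall>i<m. snd ((x + y) + (x' + y')) i = 0"
          using convex_cone_add[OF W] by (auto simp: algebra_simps)
        then show ?thesis unfolding W2_def by blast
      qed
      show "t *\<^sub>R x \<in> W2" if x: "x \<in> W2" and t: "0 \<le> t" for x t
      proof -
        from x obtain x' where x': "x' \<in> W" "\<forall>i<m. snd (x + x') i = 0"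
          unfolding W2_def by blast
        have "snd (t *\<^sub>R x + t *\<^sub>R x') i = t * snd (x + x') i" for i
          by (simp add: scaleR_fun_def algebra_simps)
        with x' have "\<forall>i<m. snd (t *\<^sub>R x + t *\<^sub>R x') i = 0" by simp
        with convex_cone_scaleR[OF W t x'(1)] show ?thesis unfolding W2_def by blast
      qed
    qed
    moreover have "h x \<in> W2" if x: "x \<in> X" for x
    proof -
      obtain F w where F: "finite F" "F \<subseteq> X" "x \<in> F" and w: "\<And>y. y \<in> F \<Longrightarrow> 0 \<le> w y" "w x > 0"
        "sum w F = 1" and P: "finite_prob X F w \<in> H"
        using properly_constrained_atom[OF pc x] by metis
      have 0: "(\<Sum>y\<in>F. w y * \<Phi> y i) = 0" if "i < m" for i
        using finite_prob_in_hypothesis_iff[OF c F(1,2) w(1,3)] P that by blast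
      \<comment> \<open>Dividing the vanishing mean by the mass of the atom \<open>x\<close> leaves
        \<open>\<Phi> x\<close> with coefficient 1; the remaining atoms form the partner of
        \<open>h x\<close>.\<close>
      define w' where "w' = (\<Sum>y\<in>F - {x}. (w y / w x) *\<^sub>R h y)"
      have "(\<Sum>y\<in>G. (w y / w x) *\<^sub>R h y) \<in> W" if "G \<subseteq> F" for G
        using finite_subset[OF that F(1)] that
      proof (induction G rule: finite_induct)
        case empty
        then show ?case using convex_cone_contains_0[OF W] by simp
      next
        case (insert y G)
        then show ?case using F w
          by (auto intro!: convex_cone_add[OF W] convex_cone_scaleR[OF W] h_W)
      qed
      then have "w' \<in> W" unfolding w'_def by blast
      moreover have "h x + w' = (\<Sum>y\<in>F. (w y / w x) *\<^sub>R h y)"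
        using w(2) F by (simp add: w'_def sum.remove[of F x])
      then have "snd (h x + w') i = (\<Sum>y\<in>F. w y * \<Phi> y i) / w x" for i
        by (simp add: snd_sum h_def sum_fun_apply scaleR_fun_def sum_divide_distrib)
      then have "\<forall>i<m. snd (h x + w') i = 0" using 0 by simp
      ultimately show ?thesis unfolding W2_def by blast
    qed
    ultimately have "W \<subseteq> W2" unfolding W_def by (intro hull_minimal) auto
    then show "\<exists>w'\<in>W. \<forall>i<m. snd (w + w') i = 0" if "w \<in> W" for w
      using that unfolding W2_def by blast
  next
    fix v assume "v \<in> W" and v0: "\<forall>i<m. snd v i = 0"
    \<comment> \<open>Up to a factor, a vector of the cone is a convex combination of generators,
      and its weights define a probability measure.\<close>
    then consider "v = 0" | t y where "0 \<le> t" "v = t *\<^sub>R y" "y \<in> convex hull (h ` X)"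
      unfolding W_def convex_cone_hull_separate conic_hull_explicit by blast
    then show "fst v \<le> 0"
    proof cases
      case 2
      from 2(3) obtain F w where F: "finite F" "F \<subseteq> X"
        and w: "\<And>x. x \<in> F \<Longrightarrow> 0 \<le> w x" "sum w F = 1" and y: "(\<Sum>x\<in>F. w x *\<^sub>R h x) = y"
        by (rule convex_hull_image_explicit) metis
      show ?thesis
      \<comment> \<open>Only for \<open>t \<noteq> 0\<close> does the vanishing of
        \<open>snd v\<close> pass to \<open>y\<close>.\<close>
      proof (cases "t = 0")
        case False
        have "snd y i = 0" if "i < m" for i
          using v0 2(2) False that by (auto simp: scaleR_fun_def)
        then have "\<forall>i<m. (\<Sum>x\<in>F. w x * \<Phi> x i) = 0"
          unfolding y[symmetric] by (simp add: snd_sum h_def sum_fun_apply scaleR_fun_def)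
        then have "finite_prob X F w \<in> H"
          using finite_prob_in_hypothesis_iff[OF c F w] by blast
        from sum_e_variable_le_1[OF E F w(1) this]
        have "fst y \<le> 0"
          unfolding y[symmetric] using w(2)
          by (simp add: fst_sum h_def right_diff_distrib sum_subtractf)
        then show ?thesis using 2 by (simp add: mult_nonneg_nonpos)
      qed (use 2 in simp)
    qed simp
  qed
  then obtain c where "\<And>w. w \<in> W \<Longrightarrow> fst w \<le> (\<Sum>i<m. c i * snd w i)" by blast
  from this[OF h_W] show thesis
    \<comment> \<open>At \<open>h x\<close> the cone inequality bounds \<open>E x - 1\<close> by the
      sum with coefficients \<open>c\<close>, hence the change of sign.\<close>
    by (intro that[of "\<lambda>i. - c i"]) (simp add: h_def sum_negf le_diff_eq algebra_simps)
qed

section \<open>The dual e-class and its optimality\<close>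

lemma dual_params_iff:
  "l \<in> dual_params X m \<Phi> \<longleftrightarrow> (\<forall>i\<ge>m. l i = 0) \<and> (\<forall>x\<in>X. dotp m l (\<Phi> x) \<le> 1)"
  by (simp add: dual_params_def topspace_Euclidean_space SUP_le_iff)

text \<open>The bound by \<open>norm1\<close> makes each coordinate of \<open>\<Phi>\<close>
  integrable, so by linearity every dual function has mean exactly 1 under each
  \<open>P \<in> H\<close>.\<close>

lemma dual_e_class_subset_e_variables:
  assumes c: "constraint X H m \<Phi>"
  shows "dual_e_class X m \<Phi> \<subseteq> e_variables X H"
proof
  fix E assume "E \<in> dual_e_class X m \<Phi>"
  then obtain l where l: "l \<in> dual_params X m \<Phi>" and E: "E = (\<lambda>x\<in>X. 1 - dotp m l (\<Phi> x))"
    unfolding dual_e_class_def by blast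
  \<comment> \<open>\<open>f\<close> is the formula without the restriction to \<open>X\<close>;
    measurability and integrals are computed for \<open>f\<close> and transferred to
    \<open>E\<close>, which agrees with it on the whole space.\<close>
  define f where "f = (\<lambda>x. 1 - dotp m l (\<Phi> x))"
  have nn: "0 \<le> f x" if "x \<in> X" for x
    using l that by (auto simp: dual_params_iff f_def)
  have \<Phi> [measurable]: "(\<lambda>x. \<Phi> x i) \<in> borel_measurable (borel_on X)" for i
    using c by (rule borel_measurable_constraint)
  have f [measurable]: "f \<in> borel_measurable (borel_on X)"
    unfolding f_def dotp_def by measurable
  have space: "space (borel_on X) = X" by (simp add: borel_on_def space_restrict_space)
  have E_eq: "E x = f x" if "x \<in> X" for x using that by (simp add: E f_def)
  have "E \<in> borel_measurable (borel_on X)"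
    using f measurable_cong[of "borel_on X" E f] E_eq by (simp add: space)
  moreover have "(\<integral>\<^sup>+x. ennreal (E x) \<partial>P) \<le> 1" if "P \<in> H" for P
  proof -
    have P: "prob_space P" "sets P = sets (borel_on X)"
      and fin: "(\<integral>\<^sup>+x. ennreal (norm1 m (\<Phi> x)) \<partial>P) < \<infinity>"
      and 0: "\<And>i. i < m \<Longrightarrow> (\<integral>x. \<Phi> x i \<partial>P) = 0"
      using that c unfolding constraint_def prob_measures_int_def prob_measures_def by auto
    interpret prob_space P by fact
    have meas: "g \<in> borel_measurable P" if "g \<in> borel_measurable (borel_on X)" for g :: "_ \<Rightarrow> real"
      using that measurable_cong_sets[OF P(2) refl] by blast
    have space_P: "space P = X" using sets_eq_imp_space_eq[OF P(2)] space by simp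
    have int: "integrable P (\<lambda>x. \<Phi> x i)" if "i < m" for i
    proof (rule integrableI_bounded)
      have "(\<integral>\<^sup>+x. ennreal (norm (\<Phi> x i)) \<partial>P) \<le> (\<integral>\<^sup>+x. ennreal (norm1 m (\<Phi> x)) \<partial>P)"
        using that by (intro nn_integral_mono ennreal_leI)
          (auto simp: norm1_def intro!: member_le_sum)
      with fin show "(\<integral>\<^sup>+x. ennreal (norm (\<Phi> x i)) \<partial>P) < \<infinity>" by (rule le_less_trans[rotated])
    qed (rule meas[OF \<Phi>])
    have int_f: "integrable P f"
      unfolding f_def dotp_def using int
      by (intro Bochner_Integration.integrable_diff Bochner_Integration.integrable_sum
          integrable_mult_right) auto
    have "(\<integral>x. f x \<partial>P) = 1 - (\<Sum>i<m. l i * (\<integral>x. \<Phi> x i \<partial>P))"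
      unfolding f_def dotp_def using int
      by (subst Bochner_Integration.integral_diff)
        (auto simp: prob_space intro!: Bochner_Integration.integrable_sum
          intro: Bochner_Integration.integral_sum[THEN trans])
    then have "(\<integral>x. f x \<partial>P) = 1" using 0 by simp
    moreover have "(\<integral>\<^sup>+x. ennreal (E x) \<partial>P) = (\<integral>\<^sup>+x. ennreal (f x) \<partial>P)"
      using E_eq by (intro nn_integral_cong) (simp add: space_P)
    moreover have "\<dots> = ennreal (\<integral>x. f x \<partial>P)"
      using nn by (intro nn_integral_eq_integral int_f AE_I2) (simp add: space_P)
    ultimately show ?thesis by simp
  qed
  ultimately show "E \<in> e_variables X H"
    using nn E_eq by (auto simp: e_variables_def E)
qed

theorem theorem1:
  fixes X :: "(real ^ 'n) set"
    and H :: "(real ^ 'n) measure set"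
    and m :: nat
    and \<Phi> :: "real ^ 'n \<Rightarrow> nat \<Rightarrow> real"
  assumes "closed X"
    and "hypothesis X H"
    and "properly_constrained X H"
    and "constraint X H m \<Phi>"
  shows "optimal X H (dual_e_class X m \<Phi>)"
proof -
  note pc = assms(3) and c = assms(4)
  have dual_majorises: "\<exists>D\<in>dual_e_class X m \<Phi>. \<forall>x\<in>X. E x \<le> D x"
    if E: "E \<in> e_variables X H" for E
  proof -
    obtain l where l: "\<And>x. x \<in> X \<Longrightarrow> E x \<le> 1 - (\<Sum>i<m. l i * \<Phi> x i)"
      using e_variable_le_dual[OF pc c E] by blast
    \<comment> \<open>Cutting off at \<open>m\<close> puts the vector into the carrier of
      \<open>Euclidean_space m\<close> without changing its products with
      \<open>\<Phi> x\<close>.\<close>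
    define l' where "l' = (\<lambda>i. if i < m then l i else 0)"
    have "dotp m l' (\<Phi> x) = (\<Sum>i<m. l i * \<Phi> x i)" for x
      by (simp add: dotp_def l'_def)
    then have le: "E x \<le> 1 - dotp m l' (\<Phi> x)" if "x \<in> X" for x
      using l that by simp
    \<comment> \<open>Nonnegativity of \<open>E\<close> is what turns the majorant into an
      admissible dual parameter.\<close>
    have "0 \<le> E x" if "x \<in> X" for x
      using E that by (auto simp: e_variables_def)
    then have "dotp m l' (\<Phi> x) \<le> 1" if "x \<in> X" for x
      using le that by fastforce
    then have "l' \<in> dual_params X m \<Phi>"
      by (simp add: dual_params_iff l'_def)
    with le show ?thesis
      unfolding dual_e_class_def by (intro bexI[of _ "\<lambda>x\<in>X. 1 - dotp m l' (\<Phi> x)"]) auto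
  qed
  have dual_eqI: "D x = D' x"
    if D: "D \<in> dual_e_class X m \<Phi>" "D' \<in> dual_e_class X m \<Phi>"
      and le: "\<And>x. x \<in> X \<Longrightarrow> D x \<le> D' x" and x: "x \<in> X" for D D' x
  proof -
    obtain F w where F: "finite F" "F \<subseteq> X" "x \<in> F" and w: "\<And>y. y \<in> F \<Longrightarrow> 0 \<le> w y" "w x > 0"
      "sum w F = 1" and P: "finite_prob X F w \<in> H"
      using properly_constrained_atom[OF pc x] by metis
    have 0: "(\<Sum>y\<in>F. w y * \<Phi> y i) = 0" if "i < m" for i
      using finite_prob_in_hypothesis_iff[OF c F(1,2) w(1,3)] P that by blast
    have mean: "(\<Sum>y\<in>F. w y * G y) = 1" if G: "G \<in> dual_e_class X m \<Phi>" for G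
    proof -
      obtain l where "G = (\<lambda>x\<in>X. 1 - dotp m l (\<Phi> x))"
        using G unfolding dual_e_class_def by blast
      then have "(\<Sum>y\<in>F. w y * G y) = (\<Sum>y\<in>F. w y - (\<Sum>i<m. l i * (w y * \<Phi> y i)))"
        using F(2) by (intro sum.cong) (auto simp: dotp_def sum_distrib_left algebra_simps)
      also have "\<dots> = 1 - (\<Sum>i<m. \<Sum>y\<in>F. l i * (w y * \<Phi> y i))"
        by (simp add: sum_subtractf w(3) sum.swap[of _ F])
      also have "\<dots> = 1"
        using 0 by (simp add: sum_distrib_left[symmetric])
      finally show ?thesis .
    qed
    \<comment> \<open>Nonnegative terms with sum zero all vanish, and the weight at \<open>x\<close>
      is positive.\<close>
    have "(\<Sum>y\<in>F. w y * (D' y - D y)) = 0"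
      using mean D by (simp add: right_diff_distrib sum_subtractf)
    moreover have "0 \<le> w y * (D' y - D y)" if "y \<in> F" for y
      using that F(2) w(1) le by auto
    ultimately have "w x * (D' x - D x) = 0"
      using F(1,3) by (simp add: sum_nonneg_eq_0_iff)
    then show ?thesis using w(2) by simp
  qed
  \<comment> \<open>Sandwich: \<open>C\<close> supplies \<open>E\<close> above \<open>D\<close>, and
    the dual class supplies \<open>D'\<close> above \<open>E\<close>. Since \<open>D\<close> and
    \<open>D'\<close> coincide on \<open>X\<close>, so does \<open>E\<close>; all values off
    \<open>X\<close> are \<open>undefined\<close>, hence \<open>E = D\<close>.\<close>
  have "D \<in> C" if maj: "majorising X H C" and D: "D \<in> dual_e_class X m \<Phi>" for C D
  proof -
    have DE: "D \<in> e_variables X H" using dual_e_class_subset_e_variables[OF c] D by blast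
    then obtain E where E: "E \<in> C" "\<forall>x\<in>X. D x \<le> E x"
      using maj unfolding majorising_def by blast
    then have EE: "E \<in> e_variables X H"
      using maj unfolding majorising_def e_class_def by blast
    then obtain D' where D': "D' \<in> dual_e_class X m \<Phi>" "\<forall>x\<in>X. E x \<le> D' x"
      using dual_majorises by blast
    have "D x = D' x" if "x \<in> X" for x
      using dual_eqI[OF D D'(1)] E(2) D'(2) that by fastforce
    then have "E x = D x" if "x \<in> X" for x
      using E(2) D'(2) that by (metis order_antisym)
    moreover have "E \<in> extensional X" "D \<in> extensional X"
      using EE DE by (auto simp: e_variables_def PiE_def)
    ultimately have "E = D" by (metis extensionalityI)
    with E(1) show ?thesis by simp
  qed
  moreover have "majorising X H (dual_e_class X m \<Phi>)"
    unfolding majorising_def e_class_def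
    using dual_e_class_subset_e_variables[OF c] dual_majorises by blast
  ultimately show ?thesis
    unfolding optimal_def by blast
qed

end
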